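(* Let $\tilde\alpha,\tilde\beta\in\mathbb{Z}$ and $\tilde J\in\mathbb{Q}$ with $\tilde\alpha\tilde J\in\mathbb{Z}$. Suppose that the quintic equation $$(\tilde s\tilde w+\tilde\alpha\,\tilde u^2)(\tilde s\tilde v^2+\tilde t^2\tilde w)+\tilde\beta\,\tilde t\tilde u^3\tilde v=\tilde J\,\tilde s\tilde t\tilde u\tilde v\tilde w \qquad ( * )$$ has an integer solution of the form $(\tilde s,\tilde t,\tilde u,\tilde v,\tilde w)=(\tau_1,\tau_2,\tau_3,\tau_4,\tau_5)$ with $|\tau_1|=1$, $|\tau_2|=1$ and non-zero $\tau_3,\tau_4,\tau_5\in\mathbb{Z}$. Then, provided that the orbit of this set of initial data under the Somos 5 recurrence $$\tau_{n+3}\tau_{n-2}=\tilde\alpha\,\tau_{n+2}\tau_{n-1}+\tilde\beta\,\tau_{n+1}\tau_n$$ is non-periodic, it produces infinitely many integer solutions $(\tilde s,\tilde t,\tilde u,\tilde v,\tilde w)=(\tau_n,\tau_{n+1},\tau_{n+2},\tau_{n+3},\tau_{n+4})$ of the Diophantine equation $( * )$.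
   Context: The recurrence is iterated from the five non-zero values $\tau_1,\dots,\tau_5$, and the orbit is the resulting sequence of quintuples $(\tau_n,\tau_{n+1},\tau_{n+2},\tau_{n+3},\tau_{n+4})$. Non-periodic means that there is no $p\ge1$ with $\tau_{n+p}=\tau_n$ for all $n$. Convention on zeros: if a zero term is encountered, the sequence is analytically continued through it. That is, $\tau_n$ is the value at the given data of the rational function of $\tilde\alpha,\tilde\beta,\tau_1,\dots,\tau_5$ obtained by iterating the recurrence formally; by the Laurent property of Fomin and Zelevinsky this function lies in $\mathbb{Z}[\tilde\alpha,\tilde\beta,\tau_1^{\pm1},\dots,\tau_5^{\pm1}]$, so it has a well-defined value when $\tau_1,\dots,\tau_5$ are non-zero.
   Formalization: The formal theorem additionally assumes that α̃ and β̃ are not both zero; if both vanish, τ_n = 0 for all n ≥ 6, so the orbit is non-periodic but has only finitely many quintuples, and the claim fails (e.g. τ_1=…=τ_5=1, J̃=2). *)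

theory Defs
  imports
    Complex_Main
    "HOL-Library.Poly_Mapping"
    "HOL-Computational_Algebra.Fraction_Field"
begin

text \<open>
  Polynomials over the integers in variables \<open>x\<^sub>0, x\<^sub>1, x\<^sub>2, \<dots>\<close>: finitely supported maps from
  monomials, which are themselves finitely supported exponent vectors, to coefficients.
\<close>

type_synonym zpoly = "(nat \<Rightarrow>\<^sub>0 nat) \<Rightarrow>\<^sub>0 int"
type_synonym ratfun = "zpoly fract"

definition variable :: "nat \<Rightarrow> ratfun" where
  "variable i = Fract (Poly_Mapping.single (Poly_Mapping.single i 1) 1) 1"

definition zpoly_eval :: "(nat \<Rightarrow> rat) \<Rightarrow> zpoly \<Rightarrow> rat" where
  "zpoly_eval a p = (\<Sum>m\<in>Poly_Mapping.keys p. of_int (Poly_Mapping.lookup p m) *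
     (\<Prod>i\<in>Poly_Mapping.keys m. a i ^ Poly_Mapping.lookup m i))"

text \<open>
  The value of a rational function at a point where it is regular, i.e. where some
  representation \<open>P / Q\<close> has a denominator that does not vanish; the value does not depend on the
  representation. It is unspecified at points where no such representation exists.
\<close>

definition ratfun_value :: "(nat \<Rightarrow> rat) \<Rightarrow> ratfun \<Rightarrow> rat" where
  "ratfun_value a r = (THE v. \<exists>P Q. r = Fract P Q \<and> zpoly_eval a Q \<noteq> 0 \<and>
     v = zpoly_eval a P / zpoly_eval a Q)"

text \<open>
  The formal Somos 5 sequence: variables 1 to 5 are the initial data, variable 6 is \<open>\<alpha>\<close> and
  variable 7 is \<open>\<beta>\<close>. Only indices from 1 on are meaningful.
\<close>

fun somos5_formal :: "nat \<Rightarrow> ratfun" where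
  "somos5_formal n =
     (if n \<le> 5 then variable n
      else (variable 6 * somos5_formal (n - 1) * somos5_formal (n - 4) +
            variable 7 * somos5_formal (n - 2) * somos5_formal (n - 3)) / somos5_formal (n - 5))"

declare somos5_formal.simps [simp del]

text \<open>
  The Somos 5 sequence, continued through zeros by specialising the formal iterates. Iterating
  numerically would be wrong: division by a zero term would yield 0.
\<close>

definition somos5 :: "int \<Rightarrow> int \<Rightarrow> int \<Rightarrow> int \<Rightarrow> int \<Rightarrow> int \<Rightarrow> int \<Rightarrow> nat \<Rightarrow> rat" where
  "somos5 \<alpha> \<beta> t1 t2 t3 t4 t5 n =
     ratfun_value
       ((\<lambda>_. 0)(1 := of_int t1, 2 := of_int t2, 3 := of_int t3, 4 := of_int t4, 5 := of_int t5,
                6 := of_int \<alpha>, 7 := of_int \<beta>))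
       (somos5_formal n)"

definition somos5_periodic :: "(nat \<Rightarrow> rat) \<Rightarrow> bool" where
  "somos5_periodic \<tau> \<longleftrightarrow> (\<exists>p\<ge>1. \<forall>n\<ge>1. \<tau> (n + p) = \<tau> n)"

definition quintic_solution ::
    "int \<Rightarrow> int \<Rightarrow> rat \<Rightarrow> rat \<times> rat \<times> rat \<times> rat \<times> rat \<Rightarrow> bool" where
  "quintic_solution \<alpha> \<beta> J = (\<lambda>(s, t, u, v, w).
     (s * w + of_int \<alpha> * u ^ 2) * (s * v ^ 2 + t ^ 2 * w) + of_int \<beta> * t * u ^ 3 * v
       = J * s * t * u * v * w)"

definition integer_quintic_solutions ::
    "int \<Rightarrow> int \<Rightarrow> rat \<Rightarrow> (rat \<times> rat \<times> rat \<times> rat \<times> rat) set" where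
  "integer_quintic_solutions \<alpha> \<beta> J =
     {x \<in> \<int> \<times> \<int> \<times> \<int> \<times> \<int> \<times> \<int>. quintic_solution \<alpha> \<beta> J x}"

text \<open>
  The orbit starts at index 1.

  Pitfall: for \<open>\<alpha> = \<beta> = 0\<close> the orbit of \<open>\<tau>\<^sub>1, \<dots>, \<tau>\<^sub>5\<close> is
  \<open>\<tau>\<^sub>1, \<dots>, \<tau>\<^sub>5, 0, 0, 0, \<dots>\<close>. It is then not periodic, yet it contains only finitely many quintuples.
\<close>

definition orbit :: "(nat \<Rightarrow> rat) \<Rightarrow> (rat \<times> rat \<times> rat \<times> rat \<times> rat) set" where
  "orbit \<tau> = {(\<tau> n, \<tau> (n + 1), \<tau> (n + 2), \<tau> (n + 3), \<tau> (n + 4)) | n. n \<ge> 1}"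

end

theory Submission
  imports Defs
begin

text \<open>
  The ratios \<open>h\<^sub>n = \<tau>\<^sub>n\<^sub>+\<^sub>2 \<tau>\<^sub>n\<^sub>-\<^sub>1 / (\<tau>\<^sub>n\<^sub>+\<^sub>1 \<tau>\<^sub>n)\<close> of a Somos 5 sequence satisfy a map of the plane that has a
  first integral \<open>J\<close>, and the quintic equation says that the orbit lies on a level set of \<open>J\<close>. Both
  the quintic and the recurrence are reversible, and on the level set \<open>h\<^sub>n\<^sub>+\<^sub>1\<close> and \<open>h\<^sub>n\<^sub>-\<^sub>1\<close> are the
  roots of a quadratic whose coefficients come from a symmetric polynomial in two variables.

  This symmetry gives a whole family of bilinear relations (lemma \<open>bilinear_relation\<close>)
  \<open>\<tau> (k + 2 i + 3) \<tau> k =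
     b (i + 1) b (i + 2) \<tau> (k + i + 3) \<tau> (k + i) - b i b (i + 3) \<tau> (k + i + 2) \<tau> (k + i + 1)\<close>,
  of which the recurrence is the case \<open>i = 1\<close>. The coefficients come from one companion sequence \<open>b\<close>,
  which depends on \<open>\<alpha>\<close>, \<open>\<beta>\<close> and \<open>J\<close> only. It is itself a Somos 5 sequence on the same level set,
  namely the one that passes through the zero \<open>b\<^sub>0 = 0\<close>; up to the normalisation of its even terms it
  is an elliptic divisibility sequence.

  The relations with \<open>k = 1\<close> and \<open>k = 2\<close> express every term by earlier ones and divide by \<open>\<tau>\<^sub>1\<close> or
  \<open>\<tau>\<^sub>2\<close> only. Applied to \<open>b\<close>, where \<open>b\<^sub>1 = b\<^sub>2 = 1\<close>, they show that \<open>b\<^sub>n\<close> is a polynomial in \<open>\<alpha>\<close>, \<open>\<beta>\<close>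
  and \<open>\<alpha> J\<close> over the integers. Applied to \<open>\<tau>\<close>, they then show that \<open>\<tau>\<^sub>n\<close> is a polynomial in
  \<open>\<alpha>\<close>, \<open>\<beta>\<close>, \<open>\<alpha> J\<close>, \<open>\<tau>\<^sub>1\<close>, \<dots>, \<open>\<tau>\<^sub>5\<close> and the inverses of \<open>\<tau>\<^sub>1\<close> and \<open>\<tau>\<^sub>2\<close>: this is the Laurent property
  in a form strong enough for integrality when \<open>\<tau>\<^sub>1\<close> and \<open>\<tau>\<^sub>2\<close> are units.

  The relations are proved in the field of rational functions, where no term of either sequence
  vanishes, as a single numerical example shows. They are then evaluated, so that they hold for the
  numerical orbit across its zeros as well. Zeros are isolated (lemma \<open>zeros_isolated\<close>), and two adjacent non-zero terms suffice to continue a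
  sequence forwards or backwards by the bilinear relations. Hence a long window that occurs twice
  forces periodicity from the start, and a non-periodic orbit is infinite.
\<close>

section \<open>Evaluation of rational functions at a point\<close>

definition monom_eval :: "(nat \<Rightarrow> rat) \<Rightarrow> (nat \<Rightarrow>\<^sub>0 nat) \<Rightarrow> rat" where
  "monom_eval a m = (\<Prod>i\<in>Poly_Mapping.keys m. a i ^ Poly_Mapping.lookup m i)"

lemma monom_eval_superset:
  assumes "finite I" "Poly_Mapping.keys m \<subseteq> I"
  shows "monom_eval a m = (\<Prod>i\<in>I. a i ^ Poly_Mapping.lookup m i)"
  unfolding monom_eval_def using assms
  by (intro prod.mono_neutral_left) (auto simp: in_keys_iff)

lemma monom_eval_add: "monom_eval a (m + m') = monom_eval a m * monom_eval a m'"
proof -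
  let ?I = "Poly_Mapping.keys m \<union> Poly_Mapping.keys m'"
  have "Poly_Mapping.keys (m + m') \<subseteq> ?I"
    by (rule Poly_Mapping.keys_add)
  then show ?thesis
    by (simp add: monom_eval_superset[of ?I] lookup_add power_add prod.distrib)
qed

lemma zpoly_eval_superset:
  assumes "finite M" "Poly_Mapping.keys p \<subseteq> M"
  shows "zpoly_eval a p = (\<Sum>m\<in>M. of_int (Poly_Mapping.lookup p m) * monom_eval a m)"
  unfolding zpoly_eval_def monom_eval_def using assms
  by (intro sum.mono_neutral_left) (auto simp: in_keys_iff)

lemma zpoly_eval_add: "zpoly_eval a (p + q) = zpoly_eval a p + zpoly_eval a q"
proof -
  let ?M = "Poly_Mapping.keys p \<union> Poly_Mapping.keys q"
  have "Poly_Mapping.keys (p + q) \<subseteq> ?M"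
    by (rule Poly_Mapping.keys_add)
  then show ?thesis
    by (simp add: zpoly_eval_superset[of ?M] lookup_add sum.distrib distrib_right)
qed

lemma zpoly_eval_0 [simp]: "zpoly_eval a 0 = 0"
  by (simp add: zpoly_eval_def)

lemma zpoly_eval_uminus: "zpoly_eval a (- p) = - zpoly_eval a p"
  using zpoly_eval_add[of a p "- p"] by simp

lemma zpoly_eval_single:
  "zpoly_eval a (Poly_Mapping.single m c) = of_int c * monom_eval a m"
  by (subst zpoly_eval_superset[of "{m}"]) auto

lemma zpoly_eval_sum: "zpoly_eval a (\<Sum>x\<in>A. f x) = (\<Sum>x\<in>A. zpoly_eval a (f x))"
  by (induction A rule: infinite_finite_induct) (simp_all add: zpoly_eval_add)

lemma zpoly_sum_monomials:
  "(\<Sum>m\<in>Poly_Mapping.keys p. Poly_Mapping.single m (Poly_Mapping.lookup p m)) = (p :: zpoly)"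
proof (rule poly_mapping_eqI)
  fix m
  have "(\<Sum>m'\<in>Poly_Mapping.keys p.
      Poly_Mapping.lookup (Poly_Mapping.single m' (Poly_Mapping.lookup p m')) m)
    = (\<Sum>m'\<in>Poly_Mapping.keys p. if m' = m then Poly_Mapping.lookup p m else 0)"
    by (intro sum.cong) (auto simp: lookup_single when_def)
  also have "\<dots> = Poly_Mapping.lookup p m"
    by (simp add: in_keys_iff)
  finally show "Poly_Mapping.lookup
      (\<Sum>m\<in>Poly_Mapping.keys p. Poly_Mapping.single m (Poly_Mapping.lookup p m)) m
    = Poly_Mapping.lookup p m"
    by (simp add: lookup_sum)
qed

text \<open>
  The two sums over keys cannot be matched directly, because cancellation may remove monomials from
  the product; splitting both factors into monomials avoids this.
\<close>

lemma zpoly_eval_mult: "zpoly_eval a (p * q) = zpoly_eval a p * zpoly_eval a q"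
proof -
  let ?s = "\<lambda>p m. Poly_Mapping.single m (Poly_Mapping.lookup p m) :: zpoly"
  have "p * q = (\<Sum>m\<in>Poly_Mapping.keys p. ?s p m) * (\<Sum>m'\<in>Poly_Mapping.keys q. ?s q m')"
    by (simp add: zpoly_sum_monomials)
  also have "\<dots> = (\<Sum>m\<in>Poly_Mapping.keys p. \<Sum>m'\<in>Poly_Mapping.keys q. ?s p m * ?s q m')"
    by (rule sum_product)
  finally have "zpoly_eval a (p * q) =
      (\<Sum>m\<in>Poly_Mapping.keys p. \<Sum>m'\<in>Poly_Mapping.keys q. zpoly_eval a (?s p m * ?s q m'))"
    by (simp add: zpoly_eval_sum)
  also have "\<dots> = (\<Sum>m\<in>Poly_Mapping.keys p. \<Sum>m'\<in>Poly_Mapping.keys q.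
      zpoly_eval a (?s p m) * zpoly_eval a (?s q m'))"
    by (simp add: mult_single zpoly_eval_single monom_eval_add mult_ac)
  also have "\<dots> = zpoly_eval a p * zpoly_eval a q"
    by (simp add: sum_product zpoly_eval_single zpoly_eval_def[of a p] zpoly_eval_def[of a q] monom_eval_def)
  finally show ?thesis .
qed

lemma zpoly_eval_1 [simp]: "zpoly_eval a 1 = 1"
  by (subst single_one[symmetric]) (simp only: zpoly_eval_single, simp add: monom_eval_def)

text \<open>
  The rational functions that are regular at a point form a local ring, on which evaluation at the
  point is a homomorphism. The rules below let identities of rational functions be evaluated by
  simplification.
\<close>

definition regular :: "(nat \<Rightarrow> rat) \<Rightarrow> ratfun \<Rightarrow> bool" where
  "regular a r \<longleftrightarrow> (\<exists>P Q. r = Fract P Q \<and> zpoly_eval a Q \<noteq> 0)"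

lemma ratfun_value_Fract:
  assumes "zpoly_eval a Q \<noteq> 0"
  shows "ratfun_value a (Fract P Q) = zpoly_eval a P / zpoly_eval a Q"
  unfolding ratfun_value_def
proof (rule the_equality)
  show "\<exists>P' Q'. Fract P Q = Fract P' Q' \<and> zpoly_eval a Q' \<noteq> 0 \<and>
      zpoly_eval a P / zpoly_eval a Q = zpoly_eval a P' / zpoly_eval a Q'"
    using assms by blast
next
  fix v
  assume "\<exists>P' Q'. Fract P Q = Fract P' Q' \<and> zpoly_eval a Q' \<noteq> 0 \<and>
      v = zpoly_eval a P' / zpoly_eval a Q'"
  then obtain P' Q' where PQ': "Fract P Q = Fract P' Q'" "zpoly_eval a Q' \<noteq> 0"
    and v: "v = zpoly_eval a P' / zpoly_eval a Q'"
    by blast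
  have "Q \<noteq> 0" "Q' \<noteq> 0"
    using assms PQ'(2) by auto
  then have "P * Q' = P' * Q"
    using PQ'(1) by (simp add: eq_fract)
  then have "zpoly_eval a P * zpoly_eval a Q' = zpoly_eval a P' * zpoly_eval a Q"
    by (metis zpoly_eval_mult)
  then show "v = zpoly_eval a P / zpoly_eval a Q"
    using assms PQ'(2) unfolding v by (simp add: frac_eq_eq)
qed

lemma regular_Fract: "zpoly_eval a Q \<noteq> 0 \<Longrightarrow> regular a (Fract P Q)"
  by (auto simp: regular_def)

lemma regularE:
  assumes "regular a r"
  obtains P Q where "r = Fract P Q" "Q \<noteq> 0" "zpoly_eval a Q \<noteq> 0"
    "ratfun_value a r = zpoly_eval a P / zpoly_eval a Q"
  using assms unfolding regular_def by (metis ratfun_value_Fract zpoly_eval_0)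

lemma
  assumes "regular a r" "regular a s"
  shows regular_add [simp]: "regular a (r + s)"
    and ratfun_value_add [simp]: "ratfun_value a (r + s) = ratfun_value a r + ratfun_value a s"
    and regular_mult [simp]: "regular a (r * s)"
    and ratfun_value_mult [simp]: "ratfun_value a (r * s) = ratfun_value a r * ratfun_value a s"
proof -
  obtain P Q where r: "r = Fract P Q" "Q \<noteq> 0" "zpoly_eval a Q \<noteq> 0"
    "ratfun_value a r = zpoly_eval a P / zpoly_eval a Q"
    using assms(1) by (rule regularE)
  obtain P' Q' where s: "s = Fract P' Q'" "Q' \<noteq> 0" "zpoly_eval a Q' \<noteq> 0"
    "ratfun_value a s = zpoly_eval a P' / zpoly_eval a Q'"
    using assms(2) by (rule regularE)
  have sum: "r + s = Fract (P * Q' + P' * Q) (Q * Q')" and prod: "r * s = Fract (P * P') (Q * Q')"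
    using r s by simp_all
  have nz: "zpoly_eval a (Q * Q') \<noteq> 0"
    using r s by (simp add: zpoly_eval_mult)
  show "regular a (r + s)" "regular a (r * s)"
    unfolding sum prod by (rule regular_Fract[OF nz])+
  show "ratfun_value a (r + s) = ratfun_value a r + ratfun_value a s"
    using r(3,4) s(3,4) unfolding sum ratfun_value_Fract[OF nz]
    by (simp add: zpoly_eval_mult zpoly_eval_add field_simps)
  show "ratfun_value a (r * s) = ratfun_value a r * ratfun_value a s"
    using r(3,4) s(3,4) unfolding prod ratfun_value_Fract[OF nz]
    by (simp add: zpoly_eval_mult)
qed

lemma
  assumes "regular a r"
  shows regular_uminus [simp]: "regular a (- r)"
    and ratfun_value_uminus [simp]: "ratfun_value a (- r) = - ratfun_value a r"
proof -
  obtain P Q where r: "r = Fract P Q" "Q \<noteq> 0" "zpoly_eval a Q \<noteq> 0"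
    "ratfun_value a r = zpoly_eval a P / zpoly_eval a Q"
    using assms(1) by (rule regularE)
  have minus: "- r = Fract (- P) Q"
    using r by simp
  show "regular a (- r)"
    unfolding minus by (rule regular_Fract[OF r(3)])
  show "ratfun_value a (- r) = - ratfun_value a r"
    unfolding minus r(4) ratfun_value_Fract[OF r(3)] by (simp add: zpoly_eval_uminus)
qed

lemma
  assumes "regular a r" "ratfun_value a r \<noteq> 0"
  shows regular_inverse: "regular a (inverse r)"
    and ratfun_value_inverse: "ratfun_value a (inverse r) = inverse (ratfun_value a r)"
proof -
  obtain P Q where r: "r = Fract P Q" "Q \<noteq> 0" "zpoly_eval a Q \<noteq> 0"
    "ratfun_value a r = zpoly_eval a P / zpoly_eval a Q"
    using assms(1) by (rule regularE)
  have nz: "zpoly_eval a P \<noteq> 0"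
    using r(4) assms(2) by auto
  have inv: "inverse r = Fract Q P"
    using r by simp
  show "regular a (inverse r)"
    unfolding inv by (rule regular_Fract[OF nz])
  show "ratfun_value a (inverse r) = inverse (ratfun_value a r)"
    unfolding inv r(4) ratfun_value_Fract[OF nz] by simp
qed

lemma
  assumes "regular a r" "regular a s"
  shows regular_diff [simp]: "regular a (r - s)"
    and ratfun_value_diff [simp]: "ratfun_value a (r - s) = ratfun_value a r - ratfun_value a s"
  using assms by (simp_all only: diff_conv_add_uminus regular_add regular_uminus
      ratfun_value_add ratfun_value_uminus)

lemma
  assumes "regular a r" "regular a s" "ratfun_value a s \<noteq> 0"
  shows regular_divide: "regular a (r / s)"
    and ratfun_value_divide: "ratfun_value a (r / s) = ratfun_value a r / ratfun_value a s"
  using assms by (simp_all add: divide_inverse regular_inverse ratfun_value_inverse)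

lemma regular_0 [simp]: "regular a 0" and ratfun_value_0 [simp]: "ratfun_value a 0 = 0"
  using regular_Fract[of a 1 0] ratfun_value_Fract[of a 1 0] by (simp_all add: fract_collapse)

lemma regular_1 [simp]: "regular a 1" and ratfun_value_1 [simp]: "ratfun_value a 1 = 1"
  using regular_Fract[of a 1 1] ratfun_value_Fract[of a 1 1] by (simp_all add: fract_collapse)

lemma
  assumes "regular a r"
  shows regular_power [simp]: "regular a (r ^ n)"
    and ratfun_value_power [simp]: "ratfun_value a (r ^ n) = ratfun_value a r ^ n"
proof -
  have "regular a (r ^ n) \<and> ratfun_value a (r ^ n) = ratfun_value a r ^ n"
    using assms by (induction n) simp_all
  then show "regular a (r ^ n)" "ratfun_value a (r ^ n) = ratfun_value a r ^ n"
    by auto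
qed

lemma regular_variable [simp]: "regular a (variable i)"
  and ratfun_value_variable [simp]: "ratfun_value a (variable i) = a i"
proof -
  show "regular a (variable i)"
    unfolding variable_def by (rule regular_Fract) simp
  have "zpoly_eval a (Poly_Mapping.single (Poly_Mapping.single i 1) 1) = a i"
    by (simp add: zpoly_eval_single monom_eval_def)
  then show "ratfun_value a (variable i) = a i"
    unfolding variable_def by (subst ratfun_value_Fract) simp_all
qed

section \<open>Somos 5 sequences on a level set of the first integral\<close>

text \<open>
  Given the recurrence \<open>z s = \<alpha> w t + \<beta> v u\<close>, the quintic polynomial in \<open>s, t, u, v, w\<close> equals \<open>s\<close>
  times the difference of the two sides below (lemma \<open>quintic_level_set\<close>). This form in six
  consecutive terms is of lower degree, free of \<open>\<beta>\<close>, and symmetric under reversal of the sequence.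
\<close>

definition level_set :: "'a::field \<Rightarrow> 'a \<Rightarrow> 'a \<Rightarrow> 'a \<Rightarrow> 'a \<Rightarrow> 'a \<Rightarrow> 'a \<Rightarrow> 'a \<Rightarrow> bool" where
  "level_set \<alpha> J s t u v w z \<longleftrightarrow>
     s * v\<^sup>2 * w + t * u\<^sup>2 * z + \<alpha> * u\<^sup>2 * v\<^sup>2 + t\<^sup>2 * w\<^sup>2 = J * t * u * v * w"

definition somos5_step :: "'a::field \<Rightarrow> 'a \<Rightarrow> (nat \<Rightarrow> 'a) \<Rightarrow> nat \<Rightarrow> bool" where
  "somos5_step \<alpha> \<beta> f n \<longleftrightarrow>
     f (n + 5) * f n = \<alpha> * f (n + 4) * f (n + 1) + \<beta> * f (n + 3) * f (n + 2)"

definition on_level :: "'a::field \<Rightarrow> 'a \<Rightarrow> (nat \<Rightarrow> 'a) \<Rightarrow> nat \<Rightarrow> bool" where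
  "on_level \<alpha> J f n \<longleftrightarrow>
     level_set \<alpha> J (f n) (f (n + 1)) (f (n + 2)) (f (n + 3)) (f (n + 4)) (f (n + 5))"

lemma quintic_level_set:
  fixes s :: "'a::field"
  assumes "z * s = \<alpha> * w * t + \<beta> * v * u"
  shows "(s * w + \<alpha> * u\<^sup>2) * (s * v\<^sup>2 + t\<^sup>2 * w) + \<beta> * t * u ^ 3 * v - J * s * t * u * v * w
    = s * (s * v\<^sup>2 * w + t * u\<^sup>2 * z + \<alpha> * u\<^sup>2 * v\<^sup>2 + t\<^sup>2 * w\<^sup>2 - J * t * u * v * w)"
  using assms by algebra

text \<open>
  Conservation of the first integral: by reversal symmetry, the quintic polynomial of the last five
  of six consecutive terms is the level set equation of all six times the \<^emph>\<open>last\<close> term, while by the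
  next step of the recurrence it is \<open>t\<close> times the shifted level set equation.
\<close>

lemma level_set_step:
  fixes s :: "'a::field"
  assumes "level_set \<alpha> J s t u v w z" "t \<noteq> 0"
    and "z * s = \<alpha> * w * t + \<beta> * v * u" "y * t = \<alpha> * z * u + \<beta> * w * v"
  shows "level_set \<alpha> J t u v w z y"
proof -
  have "t * (t * w\<^sup>2 * z + u * v\<^sup>2 * y + \<alpha> * v\<^sup>2 * w\<^sup>2 + u\<^sup>2 * z\<^sup>2 - J * u * v * w * z)
    = z * (s * v\<^sup>2 * w + t * u\<^sup>2 * z + \<alpha> * u\<^sup>2 * v\<^sup>2 + t\<^sup>2 * w\<^sup>2 - J * t * u * v * w)"
    using assms(3,4) by algebra
  also have "\<dots> = 0"
    using assms(1) by (simp add: level_set_def)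
  finally show ?thesis
    using assms(2) by (simp add: level_set_def)
qed

lemma on_level_Suc:
  assumes "on_level \<alpha> J f n" "f (n + 1) \<noteq> 0"
    "somos5_step \<alpha> \<beta> f n" "somos5_step \<alpha> \<beta> f (n + 1)"
  shows "on_level \<alpha> J f (n + 1)"
  using level_set_step[where s = "f n" and t = "f (n+1)" and u = "f (n+2)" and v = "f (n+3)" and
      w = "f (n+4)" and z = "f (n+5)" and y = "f (n+6)" and \<alpha> = \<alpha> and \<beta> = \<beta> and J = J] assms
  unfolding on_level_def somos5_step_def by (simp add: numeral_eq_Suc)

lemma on_level_all:
  assumes "on_level \<alpha> J f 1" "\<And>n. n \<ge> 1 \<Longrightarrow> f n \<noteq> 0" "\<And>n. n \<ge> 1 \<Longrightarrow> somos5_step \<alpha> \<beta> f n"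
    and "n \<ge> 1"
  shows "on_level \<alpha> J f n"
  using assms(4)
proof (induction n rule: nat_induct_at_least)
  case base
  show ?case using assms(1) .
next
  case (Suc n)
  then show ?case
    using on_level_Suc[of \<alpha> J f n \<beta>] assms(2,3) by simp
qed

text \<open>
  The initial values make the bilinear relations below trivial for \<open>i = 0\<close> and turn them into the
  recurrence for \<open>i = 1\<close>. With \<open>\<gamma>\<^sup>4 = \<alpha> J + \<beta>\<close>, multiplying the terms of even index by
  \<open>\<gamma>\<close> yields the elliptic divisibility sequence that starts with \<open>1, \<gamma>, \<alpha>, - \<beta> \<gamma>\<close>. The step that leads to index 5 would
  divide by the zero at index 0; its value is fixed instead by the level set.
\<close>

fun companion :: "'a::field \<Rightarrow> 'a \<Rightarrow> 'a \<Rightarrow> nat \<Rightarrow> 'a" where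
  "companion \<alpha> \<beta> J n =
     (if n = 0 then 0 else if n \<le> 2 then 1 else if n = 3 then \<alpha> else if n = 4 then - \<beta>
      else if n = 5 then - (\<alpha> ^ 3 + \<alpha> * J * \<beta> + \<beta>\<^sup>2)
      else (\<alpha> * companion \<alpha> \<beta> J (n - 1) * companion \<alpha> \<beta> J (n - 4) +
            \<beta> * companion \<alpha> \<beta> J (n - 2) * companion \<alpha> \<beta> J (n - 3)) / companion \<alpha> \<beta> J (n - 5))"

declare companion.simps [simp del]

lemma companion_initial [simp]:
  "companion \<alpha> \<beta> J 0 = 0" "companion \<alpha> \<beta> J (Suc 0) = 1"
  "companion \<alpha> \<beta> J (Suc (Suc 0)) = 1"
  "companion \<alpha> \<beta> J 2 = 1" "companion \<alpha> \<beta> J 3 = \<alpha>" "companion \<alpha> \<beta> J 4 = - \<beta>"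
  "companion \<alpha> \<beta> J 5 = - (\<alpha> ^ 3 + \<alpha> * J * \<beta> + \<beta>\<^sup>2)"
  by (simp_all add: companion.simps)

lemma companion_step:
  assumes "\<And>n. n \<ge> 1 \<Longrightarrow> companion \<alpha> \<beta> J n \<noteq> 0"
  shows "somos5_step \<alpha> \<beta> (companion \<alpha> \<beta> J) n"
proof (cases "n = 0")
  case True
  then show ?thesis
    by (simp add: somos5_step_def)
next
  case False
  then have "companion \<alpha> \<beta> J (n + 5) = (\<alpha> * companion \<alpha> \<beta> J (n + 4) * companion \<alpha> \<beta> J (n + 1) +
            \<beta> * companion \<alpha> \<beta> J (n + 3) * companion \<alpha> \<beta> J (n + 2)) / companion \<alpha> \<beta> J n"
    by (subst companion.simps) (simp add: numeral_eq_Suc)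
  then show ?thesis
    using assms[of n] False by (simp add: somos5_step_def)
qed

lemma companion_on_level:
  assumes "\<And>n. n \<ge> 1 \<Longrightarrow> companion \<alpha> \<beta> J n \<noteq> 0"
  shows "on_level \<alpha> J (companion \<alpha> \<beta> J) n"
proof (induction n)
  case 0
  show ?case
    by (simp add: on_level_def level_set_def power3_eq_cube power2_eq_square algebra_simps)
next
  case (Suc n)
  then show ?case
    using on_level_Suc[of \<alpha> J "companion \<alpha> \<beta> J" n \<beta>] companion_step[OF assms] assms by simp
qed

text \<open>
  Both sides are quadratic forms in \<open>w t\<close> and \<open>v u\<close>: on the left, \<open>z s\<close> is eliminated by the
  recurrence and \<open>s v\<^sup>2 w + t u\<^sup>2 z\<close> by the level set. Comparing coefficients leaves exactly the
  recurrence and the level set equation for the \<open>b\<^sub>i\<close>. In terms of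
  \<open>g(x, y) = x y (x + y) + \<alpha> (x + y) + \<beta> - J x y\<close>, whose roots in \<open>y\<close> for \<open>x = h\<^sub>n\<close> are \<open>h\<^sub>n\<^sub>+\<^sub>1\<close> and
  \<open>h\<^sub>n\<^sub>-\<^sub>1\<close>, this expresses the symmetry of \<open>g\<close>.
\<close>

lemma bilinear_product:
  fixes s :: "'a::field"
  assumes "z * s = \<alpha> * w * t + \<beta> * v * u" "level_set \<alpha> J s t u v w z"
    and "b5 * b0 = \<alpha> * b4 * b1 + \<beta> * b3 * b2" "level_set \<alpha> J b0 b1 b2 b3 b4 b5"
  shows "(b2 * b3 * (z * u) - b1 * b4 * (w * v)) * (b2 * b3 * (v * s) - b1 * b4 * (u * t))
    = (b1 * b2 * (w * t) - b0 * b3 * (v * u)) * (b3 * b4 * (w * t) - b2 * b5 * (v * u))"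
  using assms unfolding level_set_def by algebra

definition bilinear :: "(nat \<Rightarrow> 'a::comm_ring) \<Rightarrow> (nat \<Rightarrow> 'a) \<Rightarrow> bool" where
  "bilinear b f \<longleftrightarrow> (\<forall>k\<ge>1. \<forall>i. f (k + 2 * i + 3) * f k =
    b (i + 1) * b (i + 2) * (f (k + i + 3) * f (k + i))
    - b i * b (i + 3) * (f (k + i + 2) * f (k + i + 1)))"

text \<open>
  Four terms placed symmetrically around a common centre can be paired in two ways: the product of
  the outer pair and the inner pair equals the product of two intermediate pairs. This determines
  the relation for \<open>i\<close> from those for \<open>i - 1\<close> and \<open>i - 2\<close>.
\<close>

lemma bilinear_relation:
  fixes b f :: "nat \<Rightarrow> 'a::field"
  assumes b_init: "b 0 = 0" "b 1 = 1" "b 2 = 1" "b 3 = \<alpha>" "b 4 = - \<beta>"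
    and b_step: "\<And>n. somos5_step \<alpha> \<beta> b n" and b_level: "\<And>n. on_level \<alpha> J b n"
    and f_step: "\<And>n. n \<ge> 1 \<Longrightarrow> somos5_step \<alpha> \<beta> f n"
    and f_level: "\<And>n. n \<ge> 1 \<Longrightarrow> on_level \<alpha> J f n"
    and f_nz: "\<And>n. n \<ge> 1 \<Longrightarrow> f n \<noteq> 0"
  shows "bilinear b f"
  unfolding bilinear_def
proof (intro allI impI)
  fix k i :: nat
  assume "k \<ge> 1"
  then show "f (k + 2 * i + 3) * f k =
    b (i + 1) * b (i + 2) * (f (k + i + 3) * f (k + i))
    - b i * b (i + 3) * (f (k + i + 2) * f (k + i + 1))"
  proof (induction i arbitrary: k rule: less_induct)
    case (less i)
    consider "i = 0" | "i = 1" | j where "i = j + 2"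
      by (metis add.commute add_2_eq_Suc' One_nat_def not0_implies_Suc)
    then show ?case
    proof cases
      case 1
      then show ?thesis
        using b_init by (simp add: numeral_2_eq_2)
    next
      case 2
      then show ?thesis
        using b_init f_step[OF less.prems]
        by (simp add: somos5_step_def numeral_eq_Suc algebra_simps)
    next
      case 3
      \<comment> \<open>In the order of their indices, the four terms are \<open>f k\<close>, \<open>f (k + 2)\<close>, \<open>q\<close>, \<open>p\<close>.\<close>
      define p where "p = f (k + 2 * j + 7)"
      define q where "q = f (k + 2 * j + 5)"
      have up: "p * f (k + 2) = b (j + 2) * b (j + 3) * (f (k + j + 6) * f (k + j + 3))
          - b (j + 1) * b (j + 4) * (f (k + j + 5) * f (k + j + 4))"
        using less.IH[of "j + 1" "k + 2"] 3 by (simp add: p_def algebra_simps numeral_eq_Suc)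
      have down: "q * f k = b (j + 2) * b (j + 3) * (f (k + j + 4) * f (k + j + 1))
          - b (j + 1) * b (j + 4) * (f (k + j + 3) * f (k + j + 2))"
        using less.IH[of "j + 1" k] 3 less.prems by (simp add: q_def algebra_simps numeral_eq_Suc)
      have mid: "q * f (k + 2) = b (j + 1) * b (j + 2) * (f (k + j + 5) * f (k + j + 2))
          - b j * b (j + 3) * (f (k + j + 4) * f (k + j + 3))"
        using less.IH[of j "k + 2"] 3 by (simp add: q_def algebra_simps numeral_eq_Suc)
      have "(q * f (k + 2)) * (p * f k) = (p * f (k + 2)) * (q * f k)"
        by (simp add: mult_ac)
      also have "\<dots> = (b (j + 1) * b (j + 2) * (f (k + j + 5) * f (k + j + 2))
          - b j * b (j + 3) * (f (k + j + 4) * f (k + j + 3))) *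
          (b (j + 3) * b (j + 4) * (f (k + j + 5) * f (k + j + 2))
          - b (j + 2) * b (j + 5) * (f (k + j + 4) * f (k + j + 3)))"
        unfolding up down
      proof (rule bilinear_product)
        show "f (k + j + 6) * f (k + j + 1) =
            \<alpha> * f (k + j + 5) * f (k + j + 2) + \<beta> * f (k + j + 4) * f (k + j + 3)"
          using f_step[of "k + j + 1"] by (simp add: somos5_step_def algebra_simps numeral_eq_Suc)
        show "level_set \<alpha> J (f (k + j + 1)) (f (k + j + 2)) (f (k + j + 3)) (f (k + j + 4))
            (f (k + j + 5)) (f (k + j + 6))"
          using f_level[of "k + j + 1"] by (simp add: on_level_def algebra_simps numeral_eq_Suc)
        show "b (j + 5) * b j = \<alpha> * b (j + 4) * b (j + 1) + \<beta> * b (j + 3) * b (j + 2)"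
          using b_step[of j] by (simp add: somos5_step_def)
        show "level_set \<alpha> J (b j) (b (j + 1)) (b (j + 2)) (b (j + 3)) (b (j + 4)) (b (j + 5))"
          using b_level[of j] by (simp add: on_level_def)
      qed
      also have "\<dots> = (q * f (k + 2)) *
          (b (j + 3) * b (j + 4) * (f (k + j + 5) * f (k + j + 2))
          - b (j + 2) * b (j + 5) * (f (k + j + 4) * f (k + j + 3)))"
        unfolding mid ..
      finally have "p * f k = b (j + 3) * b (j + 4) * (f (k + j + 5) * f (k + j + 2))
          - b (j + 2) * b (j + 5) * (f (k + j + 4) * f (k + j + 3))"
        using f_nz[of "k + 2"] f_nz[of "k + 2 * j + 5"] by (simp add: q_def)
      then show ?thesis
        using 3 by (simp add: p_def algebra_simps numeral_eq_Suc)
    qed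
  qed
qed

section \<open>Consequences of the bilinear relations\<close>

lemma odd_or_even_above_5:
  assumes "n \<ge> 5"
  obtains d i :: nat where "d = 0 \<or> d = 1" "n = d + 2 * i + 3" "i \<ge> 1"
proof
  show "(n - 3) mod 2 = 0 \<or> (n - 3) mod 2 = 1" "n = (n - 3) mod 2 + 2 * ((n - 3) div 2) + 3"
    "(n - 3) div 2 \<ge> 1"
    using assms by presburger+
qed

text \<open>
  The relations with \<open>k = 1\<close> (for even \<open>n\<close>) and \<open>k = 2\<close> (for odd \<open>n\<close>). Since \<open>n \<ge> 6\<close> gives \<open>i \<ge> 1\<close>, all
  indices on the right are below \<open>n\<close>.
\<close>

lemma bilinear_generated:
  fixes b f :: "nat \<Rightarrow> 'a::field"
  assumes "bilinear b f" "f 1 \<noteq> 0" "f 2 \<noteq> 0" "inverse (f 1) \<in> S" "inverse (f 2) \<in> S"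
    and diff: "\<And>x y. x \<in> S \<Longrightarrow> y \<in> S \<Longrightarrow> x - y \<in> S"
    and mult: "\<And>x y. x \<in> S \<Longrightarrow> y \<in> S \<Longrightarrow> x * y \<in> S"
    and "n \<ge> 6"
    and bS: "\<And>j. j < n \<Longrightarrow> b j \<in> S" and fS: "\<And>j. 1 \<le> j \<Longrightarrow> j < n \<Longrightarrow> f j \<in> S"
  shows "f n \<in> S"
proof -
  obtain d i :: nat where d: "d = 0 \<or> d = 1" and "n - 1 = d + 2 * i + 3" and i: "i \<ge> 1"
  proof (rule odd_or_even_above_5)
    show "n - 1 \<ge> 5"
      using \<open>n \<ge> 6\<close> by simp
  qed
  then obtain k where k: "k = 1 \<or> k = 2" and n: "n = k + 2 * i + 3"
    using that[of "Suc d"] \<open>n \<ge> 6\<close> by auto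
  have "f n * f k = b (i + 1) * b (i + 2) * (f (k + i + 3) * f (k + i)) -
      b i * b (i + 3) * (f (k + i + 2) * f (k + i + 1))"
    using assms(1)[unfolded bilinear_def, rule_format, of k i] k unfolding n by auto
  moreover have "\<dots> \<in> S"
    using k i n by (intro diff mult bS fS) auto
  ultimately have "(f n * f k) * inverse (f k) \<in> S"
    using k assms(4,5) by (auto intro: mult)
  moreover have "f k \<noteq> 0"
    using k assms(2,3) by blast
  ultimately show ?thesis
    by (simp add: divide_inverse[symmetric])
qed

text \<open>
  With \<open>j\<close> and \<open>j + 1\<close> as the lower index \<open>k\<close>, the bilinear relations determine all terms beyond a
  window of five from that window, by dividing only by the two terms that are known not to vanish.
\<close>

lemma bilinear_forward:
  fixes T :: "nat \<Rightarrow> 'a::field"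
  assumes "bilinear b T" "j \<ge> 1" "T j \<noteq> 0" "T (j + 1) \<noteq> 0"
    and window: "\<And>i. i < 5 \<Longrightarrow> T (j + i + p) = T (j + i)"
  shows "T (j + n + p) = T (j + n)"
proof (induction n rule: less_induct)
  case (less n)
  show ?case
  proof (cases "n < 5")
    case True
    then show ?thesis by (rule window)
  next
    case False
    obtain d i :: nat where d: "d = 0 \<or> d = 1" and n: "n = d + 2 * i + 3" and i: "i \<ge> 1"
      using False odd_or_even_above_5[of n] by (metis not_less)
    have IH: "T (j + d + p + m) = T (j + d + m)" if "d + m < n" for m
      using less.IH[OF that] by (simp add: add_ac)
    have "T (j + n + p) * T (j + d + p) =
        b (i + 1) * b (i + 2) * (T (j + d + p + i + 3) * T (j + d + p + i)) -
        b i * b (i + 3) * (T (j + d + p + i + 2) * T (j + d + p + i + 1))"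
      using assms(1)[unfolded bilinear_def, rule_format, of "j + d + p" i] \<open>j \<ge> 1\<close>
      by (simp add: n add_ac)
    also have "\<dots> = b (i + 1) * b (i + 2) * (T (j + d + i + 3) * T (j + d + i)) -
        b i * b (i + 3) * (T (j + d + i + 2) * T (j + d + i + 1))"
      using IH[of "i + 3"] IH[of "i + 2"] IH[of "i + 1"] IH[of i] i n by (simp add: add_ac)
    also have "\<dots> = T (j + n) * T (j + d)"
      using assms(1)[unfolded bilinear_def, rule_format, of "j + d" i] \<open>j \<ge> 1\<close>
      by (simp add: n add_ac)
    finally show ?thesis
      using IH[of 0] n d assms(3,4) by auto
  qed
qed

text \<open>
  The mirror image: \<open>e\<close> and \<open>e - 1\<close> now serve as the upper index \<open>k + 2 i + 3\<close>.
\<close>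

lemma bilinear_backward:
  fixes T :: "nat \<Rightarrow> 'a::field"
  assumes "bilinear b T" "T e \<noteq> 0" "T (e - 1) \<noteq> 0"
    and window: "\<And>k. e \<le> k + 4 \<Longrightarrow> k \<le> e \<Longrightarrow> T (k + p) = T k"
    and "1 \<le> k" "k \<le> e"
  shows "T (k + p) = T k"
  using assms(5,6)
proof (induction "e - k" arbitrary: k rule: less_induct)
  case less
  show ?case
  proof (cases "e \<le> k + 4")
    case True
    then show ?thesis using window less.prems by blast
  next
    case False
    obtain d i :: nat where d: "d = 0 \<or> d = 1" and e: "e = k + d + 2 * i + 3" and i: "i \<ge> 1"
    proof (rule odd_or_even_above_5)
      show "e - k \<ge> 5"
        using False by simp
      fix d i
      assume "d = 0 \<or> d = 1" "e - k = d + 2 * i + 3" "i \<ge> 1"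
      then show thesis
        using False by (intro that[of d i]) simp_all
    qed
    define r where "r = k + 2 * i + 3"
    have r: "T r \<noteq> 0"
      using d assms(2,3) e by (auto simp: r_def numeral_eq_Suc)
    have IH: "T (k + p + m) = T (k + m)" if "1 \<le> m" "k + m \<le> e" for m
      using less.hyps[of "k + m"] that less.prems by (simp add: add_ac)
    have "T (k + p) * T (r + p) = b (i + 1) * b (i + 2) * (T (k + p + i + 3) * T (k + p + i)) -
        b i * b (i + 3) * (T (k + p + i + 2) * T (k + p + i + 1))"
      using assms(1)[unfolded bilinear_def, rule_format, of "k + p" i] \<open>k \<ge> 1\<close>
      by (simp add: r_def mult.commute add_ac)
    also have "\<dots> = b (i + 1) * b (i + 2) * (T (k + i + 3) * T (k + i)) -
        b i * b (i + 3) * (T (k + i + 2) * T (k + i + 1))"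
      using IH[of "i + 3"] IH[of "i + 2"] IH[of "i + 1"] IH[of i] i e by (simp add: add_ac)
    also have "\<dots> = T k * T r"
      using assms(1)[unfolded bilinear_def, rule_format, of k i] \<open>k \<ge> 1\<close>
      by (simp add: r_def mult.commute add_ac)
    finally show ?thesis
      using IH[of "2 * i + 3"] e r by (simp add: r_def add_ac)
  qed
qed

definition isolated_zeros :: "(nat \<Rightarrow> 'a::zero) \<Rightarrow> nat \<Rightarrow> bool" where
  "isolated_zeros T n \<longleftrightarrow> (\<forall>i<5. \<forall>j<5. T (n + i) = 0 \<longrightarrow> T (n + j) = 0 \<longrightarrow> i = j)"

lemma all_less_5: "(\<forall>i<5. P i) \<longleftrightarrow> P 0 \<and> P 1 \<and> P 2 \<and> P 3 \<and> P (4::nat)"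
  by (auto simp: numeral_eq_Suc less_Suc_eq)

text \<open>
  If exactly one of \<open>\<alpha>\<close>, \<open>\<beta>\<close> vanishes, the right-hand side is a single monomial and no zero ever appears. Otherwise a new
  zero together with a zero among the four preceding terms would make one of the two monomials
  \<open>\<alpha> \<tau>\<^sub>n\<^sub>+\<^sub>4 \<tau>\<^sub>n\<^sub>+\<^sub>1\<close> and \<open>\<beta> \<tau>\<^sub>n\<^sub>+\<^sub>3 \<tau>\<^sub>n\<^sub>+\<^sub>2\<close> vanish, hence both, which requires two zeros among the four. If
  \<open>\<tau>\<^sub>n = 0\<close>, the next term is left free by the recurrence, but that zero then drops out of the window.
\<close>

lemma zeros_isolated:
  fixes T :: "nat \<Rightarrow> 'a::field"
  assumes step: "\<And>n. n \<ge> 1 \<Longrightarrow> somos5_step \<alpha> \<beta> T n"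
    and init: "\<And>n. 1 \<le> n \<Longrightarrow> n \<le> 5 \<Longrightarrow> T n \<noteq> 0"
    and "\<alpha> \<noteq> 0 \<or> \<beta> \<noteq> 0" and "n \<ge> 1"
  shows "isolated_zeros T n"
proof (cases "\<alpha> = 0 \<or> \<beta> = 0")
  case True
  have nz: "T n \<noteq> 0" if "n \<ge> 1" for n
    using that
  proof (induction n rule: less_induct)
    case (less n)
    show ?case
    proof (cases "n \<le> 5")
      case True
      then show ?thesis using init less.prems by blast
    next
      case False
      define m where "m = n - 5"
      have n: "n = m + 5" and m: "m \<ge> 1"
        using False by (simp_all add: m_def)
      show ?thesis
        using step[OF m] less.IH[of "m + 1"] less.IH[of "m + 2"] less.IH[of "m + 3"]
          less.IH[of "m + 4"] m True assms(3)
        by (auto simp: somos5_step_def n)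
    qed
  qed
  then show ?thesis
    using \<open>n \<ge> 1\<close> by (simp add: isolated_zeros_def)
next
  case False
  show ?thesis
    using \<open>n \<ge> 1\<close>
  proof (induction n rule: nat_induct_at_least)
    case base
    then show ?case using init by (simp add: isolated_zeros_def)
  next
    case (Suc n)
    have IH: "i = j" if "T (n + i) = 0" "T (n + j) = 0" "i < 5" "j < 5" for i j
      using Suc.IH that unfolding isolated_zeros_def by blast
    have new: "T (n + 5) \<noteq> 0" if "T (n + j) = 0" "j \<in> {1..4}" for j
    proof
      assume "T (n + 5) = 0"
      then have eq: "\<alpha> * T (n + 4) * T (n + 1) + \<beta> * T (n + 3) * T (n + 2) = 0"
        using step[of n] Suc.hyps by (simp add: somos5_step_def)
      have "j = 1 \<or> j = 2 \<or> j = 3 \<or> j = 4"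
        using that(2) by auto
      then have "(T (n + 1) = 0 \<or> T (n + 4) = 0) \<and> (T (n + 2) = 0 \<or> T (n + 3) = 0)"
        using that(1) eq False by (elim disjE) (simp_all add: disj_commute)
      then show False
        using IH[of 1 2] IH[of 1 3] IH[of 4 2] IH[of 4 3] by auto
    qed
    show ?case
      unfolding isolated_zeros_def
    proof (intro allI impI)
      fix i j :: nat
      assume "i < 5" "j < 5" and "T (Suc n + i) = 0" "T (Suc n + j) = 0"
      then have ij: "i \<le> 4" "j \<le> 4" "T (n + (i + 1)) = 0" "T (n + (j + 1)) = 0"
        by simp_all
      show "i = j"
      proof (cases "i = 4 \<or> j = 4")
        case True
        then have "T (n + 5) = 0"
          using ij by (elim disjE) (simp_all only: numeral_eq_Suc, simp_all)
        then have "i + 1 \<notin> {1..4}" "j + 1 \<notin> {1..4}"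
          using new ij by blast+
        then show ?thesis
          using ij(1,2) by simp
      next
        case False
        then show ?thesis
          using IH[OF ij(3,4)] ij(1,2) by simp
      qed
    qed
  qed
qed

lemma isolated_zeros_adjacent_nonzero:
  assumes "isolated_zeros T n"
  obtains i where "i \<le> 2" "T (n + i) \<noteq> 0" "T (n + i + 1) \<noteq> 0"
proof -
  have zero: "i = j" if "T (n + i) = 0" "T (n + j) = 0" "i < 5" "j < 5" for i j
    using assms that unfolding isolated_zeros_def by blast
  show ?thesis
  proof (cases "T (n + 0) = 0 \<or> T (n + 1) = 0")
    case True
    then have "T (n + 2) \<noteq> 0" "T (n + 3) \<noteq> 0"
      using zero[of 0 2] zero[of 1 2] zero[of 0 3] zero[of 1 3] by auto
    then show ?thesis
      using that[of 2] by (simp add: numeral_eq_Suc)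
  next
    case False
    then show ?thesis
      using that[of 0] by simp
  qed
qed

text \<open>
  In a finite orbit some window of ten terms occurs twice. It contains a pair of adjacent non-zero
  terms with enough known terms after it to go forwards, and one with enough before it to go
  backwards down to index 1.
\<close>

lemma finite_orbit_periodic:
  fixes T :: "nat \<Rightarrow> rat"
  assumes "bilinear b T" and iso: "\<And>n. n \<ge> 1 \<Longrightarrow> isolated_zeros T n"
    and fin: "finite (orbit T)"
  shows "somos5_periodic T"
proof -
  define Q where "Q n = (T n, T (n + 1), T (n + 2), T (n + 3), T (n + 4))" for n
  have Q_orbit: "Q n \<in> orbit T" if "n \<ge> 1" for n
    using that unfolding orbit_def Q_def by blast
  have Q_eq: "T (m + i) = T (n + i)" if "Q m = Q n" "i < 5" for m n i
  proof -
    have "\<forall>i<5. T (m + i) = T (n + i)"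
      using that(1) unfolding all_less_5 Q_def by simp
    then show ?thesis
      using that(2) by blast
  qed
  have "(\<lambda>n. (Q n, Q (n + 5))) ` {1..} \<subseteq> orbit T \<times> orbit T"
    by (intro image_subsetI SigmaI Q_orbit) simp_all
  then have "finite ((\<lambda>n. (Q n, Q (n + 5))) ` {1..})"
    by (rule finite_subset) (intro finite_cartesian_product fin)
  then have "\<not> inj_on (\<lambda>n. (Q n, Q (n + 5))) {1::nat..}"
    using infinite_Ici[of "1::nat"] by (meson finite_imageD)
  then obtain x y where xy: "1 \<le> x" "1 \<le> y" "x \<noteq> y" "Q x = Q y" "Q (x + 5) = Q (y + 5)"
    unfolding inj_on_def by auto
  obtain k l where kl: "1 \<le> k" "k < l" "Q k = Q l" "Q (k + 5) = Q (l + 5)"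
  proof (cases "x < y")
    case True
    then show thesis
      using xy by (intro that[of x y])
  next
    case False
    then show thesis
      using xy by (intro that[of y x]) simp_all
  qed
  define p where "p = l - k"
  have l: "l = k + p" and p: "p \<ge> 1"
    using kl by (simp_all add: p_def)
  \<comment> \<open>Two adjacent quintuples are compared at once, so ten consecutive terms agree.\<close>
  have window: "T (k + i + p) = T (k + i)" if "i < 10" for i
  proof (cases "i < 5")
    case True
    then show ?thesis
      using Q_eq[OF kl(3), of i] by (simp add: l add_ac)
  next
    case False
    then show ?thesis
      using Q_eq[OF kl(4), of "i - 5"] that by (simp add: l add_ac)
  qed
  obtain i where i: "i \<le> 2" "T (k + i) \<noteq> 0" "T (k + i + 1) \<noteq> 0"
    using isolated_zeros_adjacent_nonzero[OF iso[OF kl(1)]] by blast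
  obtain j where j: "6 \<le> j" "j \<le> 9" "T (k + j) \<noteq> 0" "T (k + j - 1) \<noteq> 0"
  proof -
    obtain j where "j \<le> 2" "T (k + 5 + j) \<noteq> 0" "T (k + 5 + j + 1) \<noteq> 0"
      using isolated_zeros_adjacent_nonzero[of T "k + 5"] iso[of "k + 5"] kl(1) by auto
    then show ?thesis
      using that[of "j + 6"] by (simp add: numeral_eq_Suc add_ac)
  qed
  have "T (n + p) = T n" if "n \<ge> 1" for n
  proof (cases "n \<le> k + j")
    case True
    show ?thesis
    proof (rule bilinear_backward[OF assms(1) j(3,4) _ that True])
      fix m
      assume "k + j \<le> m + 4" "m \<le> k + j"
      then show "T (m + p) = T m"
        using window[of "m - k"] j by simp
    qed
  next
    case False
    have "T (k + i + m + p) = T (k + i + m)" if "m < 5" for m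
      using window[of "i + m"] that i(1) by (simp add: add.assoc)
    from bilinear_forward[OF assms(1) _ i(2,3) this]
    have "T (k + i + (n - (k + i)) + p) = T (k + i + (n - (k + i)))"
      using kl(1) by simp
    then show ?thesis
      using False i(1) j(1) by simp
  qed
  then show ?thesis
    using p by (auto simp: somos5_periodic_def)
qed

section \<open>The formal sequence\<close>

definition formal_J :: ratfun where
  "formal_J =
     ((variable 1 * variable 5 + variable 6 * (variable 3)\<^sup>2) *
      (variable 1 * (variable 4)\<^sup>2 + (variable 2)\<^sup>2 * variable 5) +
      variable 7 * variable 2 * variable 3 ^ 3 * variable 4)
     / (variable 1 * variable 2 * variable 3 * variable 4 * variable 5)"

definition formal_companion :: "nat \<Rightarrow> ratfun" where
  "formal_companion = companion (variable 6) (variable 7) formal_J"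

lemma formal_J_value:
  assumes "a 1 \<noteq> 0" "a 2 \<noteq> 0" "a 3 \<noteq> 0" "a 4 \<noteq> 0" "a 5 \<noteq> 0"
  shows "regular a formal_J"
    and "ratfun_value a formal_J =
      ((a 1 * a 5 + a 6 * (a 3)\<^sup>2) * (a 1 * (a 4)\<^sup>2 + (a 2)\<^sup>2 * a 5) + a 7 * a 2 * a 3 ^ 3 * a 4)
      / (a 1 * a 2 * a 3 * a 4 * a 5)"
  unfolding formal_J_def using assms by (simp_all add: regular_divide ratfun_value_divide)

text \<open>
  A point at which no term vanishes shows that the formal terms are non-zero. The degenerate
  elliptic divisibility sequence \<open>1, 2, 3, \<dots>\<close> provides one: halving its terms of even index gives
  the companion sequence for \<open>\<alpha> = 3\<close>, \<open>\<beta> = - 2\<close> and \<open>J = 6\<close>. At that point the formal Somos 5 sequence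
  and its companion take the same values.
\<close>

definition half_even :: "nat \<Rightarrow> rat" where
  "half_even n = (if even n then of_nat n / 2 else of_nat n)"

definition half_even_point :: "nat \<Rightarrow> rat" where
  "half_even_point = (\<lambda>_. 0)(1 := 1, 2 := 1, 3 := 3, 4 := 2, 5 := 5, 6 := 3, 7 := - 2)"

lemma half_even_initial:
  "half_even 1 = 1" "half_even 2 = 1" "half_even 3 = 3" "half_even 4 = 2" "half_even 5 = 5"
  by (simp_all add: half_even_def)

lemma half_even_step:
  "half_even (n + 5) * half_even n =
     3 * half_even (n + 4) * half_even (n + 1) - 2 * half_even (n + 3) * half_even (n + 2)"
  by (cases "even n") (simp_all add: half_even_def field_simps)

lemma value_half_even:
  fixes f :: "nat \<Rightarrow> ratfun"
  assumes init: "\<And>n. n \<in> {1..5} \<Longrightarrow> regular half_even_point (f n)"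
      "\<And>n. n \<in> {1..5} \<Longrightarrow> ratfun_value half_even_point (f n) = half_even n"
    and step: "\<And>n. n \<ge> 1 \<Longrightarrow> f (n + 5) =
      (variable 6 * f (n + 4) * f (n + 1) + variable 7 * f (n + 3) * f (n + 2)) / f n"
    and "n \<ge> 1"
  shows "regular half_even_point (f n) \<and> ratfun_value half_even_point (f n) = half_even n"
  using \<open>n \<ge> 1\<close>
proof (induction n rule: less_induct)
  case (less n)
  show ?case
  proof (cases "n \<le> 5")
    case True
    then show ?thesis
      using init less.prems by simp
  next
    case False
    define m where "m = n - 5"
    have n: "n = m + 5" and m: "m \<ge> 1"
      using False by (simp_all add: m_def)
    have IH: "regular half_even_point (f (m + j))"
      "ratfun_value half_even_point (f (m + j)) = half_even (m + j)" if "j < 5" for j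
      using less.IH[of "m + j"] that m n by simp_all
    have nz: "half_even m \<noteq> 0"
      using m by (simp add: half_even_def)
    have a: "half_even_point 6 = 3" "half_even_point 7 = - 2"
      by (simp_all add: half_even_point_def)
    have "half_even n = (3 * half_even (m + 4) * half_even (m + 1) +
        - 2 * half_even (m + 3) * half_even (m + 2)) / half_even m"
      using half_even_step[of m] nz n by (simp add: nonzero_eq_divide_eq)
    then show ?thesis
      unfolding n step[OF m] using IH[of 0] IH[of 1] IH[of 2] IH[of 3] IH[of 4] nz n a
      by (simp add: regular_divide ratfun_value_divide)
  qed
qed

lemma nonzero_if_half_even:
  assumes "regular half_even_point r \<and> ratfun_value half_even_point r = half_even n" "n \<ge> 1"
  shows "r \<noteq> 0"
  using assms by (auto simp: half_even_def split: if_splits)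

lemma one_to_five: "n \<in> {1..5::nat} \<longleftrightarrow> n = 1 \<or> n = 2 \<or> n = 3 \<or> n = 4 \<or> n = 5"
  by auto

lemma somos5_formal_initial:
  "n \<le> 5 \<Longrightarrow> somos5_formal n = variable n"
  by (simp add: somos5_formal.simps)

lemma somos5_formal_rec:
  assumes "n \<ge> 1"
  shows "somos5_formal (n + 5) =
    (variable 6 * somos5_formal (n + 4) * somos5_formal (n + 1) +
     variable 7 * somos5_formal (n + 3) * somos5_formal (n + 2)) / somos5_formal n"
  using assms by (subst somos5_formal.simps) (simp add: numeral_eq_Suc)

lemma somos5_formal_nonzero:
  assumes "n \<ge> 1"
  shows "somos5_formal n \<noteq> 0"
proof (rule nonzero_if_half_even[OF value_half_even])
  fix n :: nat
  assume "n \<in> {1..5}"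
  then show "regular half_even_point (somos5_formal n)"
    "ratfun_value half_even_point (somos5_formal n) = half_even n"
    unfolding one_to_five
    by (auto simp: somos5_formal_initial half_even_point_def half_even_def)
qed (use assms somos5_formal_rec in auto)

lemma formal_companion_nonzero:
  assumes "n \<ge> 1"
  shows "formal_companion n \<noteq> 0"
proof (rule nonzero_if_half_even[OF value_half_even])
  have a: "half_even_point 1 = 1" "half_even_point 2 = 1" "half_even_point 3 = 3"
    "half_even_point 4 = 2" "half_even_point 5 = 5" "half_even_point 6 = 3" "half_even_point 7 = - 2"
    by (simp_all add: half_even_point_def)
  have J: "regular half_even_point formal_J" "ratfun_value half_even_point formal_J = 6"
    using formal_J_value[of half_even_point] by (simp_all add: a a(1)[simplified])
  fix n :: nat
  assume "n \<in> {1..5}"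
  then show "regular half_even_point (formal_companion n)"
    "ratfun_value half_even_point (formal_companion n) = half_even n"
    unfolding one_to_five formal_companion_def using J
    by (auto simp: a half_even_initial[simplified])
next
  fix n :: nat
  assume "n \<ge> 1"
  then show "formal_companion (n + 5) =
    (variable 6 * formal_companion (n + 4) * formal_companion (n + 1) +
     variable 7 * formal_companion (n + 3) * formal_companion (n + 2)) / formal_companion n"
    unfolding formal_companion_def by (subst companion.simps) (simp add: numeral_eq_Suc)
qed (use assms in auto)

lemma formal_companion_law:
  "somos5_step (variable 6) (variable 7) formal_companion n"
  "on_level (variable 6) formal_J formal_companion n"
  using companion_step companion_on_level formal_companion_nonzero
  unfolding formal_companion_def by blast+

lemma somos5_formal_step:
  assumes "n \<ge> 1"
  shows "somos5_step (variable 6) (variable 7) somos5_formal n"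
  using somos5_formal_rec[OF assms] somos5_formal_nonzero[OF assms]
  by (simp add: somos5_step_def)

lemma somos5_formal_level:
  assumes "n \<ge> 1"
  shows "on_level (variable 6) formal_J somos5_formal n"
proof (rule on_level_all)
  let ?x = somos5_formal
  have x: "?x 1 = variable 1" "?x 2 = variable 2" "?x 3 = variable 3" "?x 4 = variable 4"
    "?x 5 = variable 5"
    by (simp_all add: somos5_formal_initial)
  have nz: "variable 1 \<noteq> 0" "variable 2 \<noteq> 0" "variable 3 \<noteq> 0" "variable 4 \<noteq> 0" "variable 5 \<noteq> 0"
    using somos5_formal_nonzero[of 1] somos5_formal_nonzero[of 2] somos5_formal_nonzero[of 3]
      somos5_formal_nonzero[of 4] somos5_formal_nonzero[of 5] by (simp_all add: x[simplified])
  have rec: "?x 6 * ?x 1 = variable 6 * ?x 5 * ?x 2 + variable 7 * ?x 4 * ?x 3"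
    using somos5_formal_step[of 1] by (simp add: somos5_step_def numeral_eq_Suc)
  have "(?x 1 * ?x 5 + variable 6 * (?x 3)\<^sup>2) * (?x 1 * (?x 4)\<^sup>2 + (?x 2)\<^sup>2 * ?x 5) +
      variable 7 * ?x 2 * ?x 3 ^ 3 * ?x 4 - formal_J * ?x 1 * ?x 2 * ?x 3 * ?x 4 * ?x 5 = 0"
    unfolding x formal_J_def using nz by (simp add: mult.assoc)
  then have "level_set (variable 6) formal_J (?x 1) (?x 2) (?x 3) (?x 4) (?x 5) (?x 6)"
    unfolding quintic_level_set[OF rec] using somos5_formal_nonzero[of 1]
    by (simp add: level_set_def)
  then show "on_level (variable 6) formal_J ?x 1"
    by (simp add: on_level_def numeral_eq_Suc)
qed (use assms somos5_formal_step somos5_formal_nonzero in auto)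

lemma formal_bilinear:
  assumes "\<And>n. n \<ge> 1 \<Longrightarrow> somos5_step (variable 6) (variable 7) f n"
    and "\<And>n. n \<ge> 1 \<Longrightarrow> on_level (variable 6) formal_J f n"
    and "\<And>n. n \<ge> 1 \<Longrightarrow> f n \<noteq> 0"
  shows "bilinear formal_companion f"
  using bilinear_relation[of formal_companion, OF _ _ _ _ _ formal_companion_law assms]
  by (simp add: formal_companion_def)

section \<open>Integrality of the values\<close>

definition integral_at :: "(nat \<Rightarrow> rat) \<Rightarrow> ratfun set" where
  "integral_at a = {r. regular a r \<and> ratfun_value a r \<in> \<int>}"

lemma integral_at_diff: "x \<in> integral_at a \<Longrightarrow> y \<in> integral_at a \<Longrightarrow> x - y \<in> integral_at a"
  and integral_at_add: "x \<in> integral_at a \<Longrightarrow> y \<in> integral_at a \<Longrightarrow> x + y \<in> integral_at a"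
  and integral_at_mult: "x \<in> integral_at a \<Longrightarrow> y \<in> integral_at a \<Longrightarrow> x * y \<in> integral_at a"
  and integral_at_uminus: "x \<in> integral_at a \<Longrightarrow> - x \<in> integral_at a"
  and integral_at_power: "x \<in> integral_at a \<Longrightarrow> x ^ n \<in> integral_at a"
  and integral_at_0: "0 \<in> integral_at a"
  and integral_at_1: "1 \<in> integral_at a"
  by (auto simp: integral_at_def)

text \<open>
  The recurrence for the companion sequence divides by its own terms, but as a Somos 5 sequence on
  the level set it satisfies the bilinear relations with itself as coefficients, where the divisors
  are \<open>b\<^sub>1 = b\<^sub>2 = 1\<close>.
\<close>

lemma formal_companion_integral:
  assumes "variable 6 \<in> integral_at a" "variable 7 \<in> integral_at a" "variable 6 * formal_J \<in> integral_at a"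
  shows "formal_companion n \<in> integral_at a"
proof (induction n rule: less_induct)
  case (less n)
  show ?case
  proof (cases "n \<ge> 6")
    case True
    show ?thesis
    proof (rule bilinear_generated[where b = formal_companion])
      show "bilinear formal_companion formal_companion"
        by (intro formal_bilinear formal_companion_law formal_companion_nonzero)
    qed (use True less.IH in \<open>auto simp: formal_companion_def integral_at_1 integral_at_diff integral_at_mult\<close>)
  next
    case False
    then consider "n = 0" | "n = 1" | "n = 2" | "n = 3" | "n = 4" | "n = 5"
      by linarith
    then show ?thesis
      by cases (simp_all add: formal_companion_def assms integral_at_0 integral_at_1
        integral_at_uminus integral_at_add integral_at_mult integral_at_diff integral_at_power)
  qed
qed

text \<open>
  Regularity and integrality of the values follow together: the bilinear relations build each term
  from integral ones, without division by \<open>\<tau>\<^sub>3\<close>, \<open>\<tau>\<^sub>4\<close> or \<open>\<tau>\<^sub>5\<close>.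
\<close>

lemma somos5_formal_integral:
  assumes "\<And>n. formal_companion n \<in> integral_at a"
    and "\<And>n. 1 \<le> n \<Longrightarrow> n \<le> 5 \<Longrightarrow> variable n \<in> integral_at a"
    and "inverse (variable 1) \<in> integral_at a" "inverse (variable 2) \<in> integral_at a"
    and "n \<ge> 1"
  shows "somos5_formal n \<in> integral_at a"
  using assms(5)
proof (induction n rule: less_induct)
  case (less n)
  show ?case
  proof (cases "n \<ge> 6")
    case True
    show ?thesis
    proof (rule bilinear_generated[where b = formal_companion])
      show "bilinear formal_companion somos5_formal"
        by (intro formal_bilinear somos5_formal_step somos5_formal_level somos5_formal_nonzero)
      show "somos5_formal 1 \<noteq> 0" "somos5_formal 2 \<noteq> 0"
        by (simp_all add: somos5_formal_nonzero)
    qed (use True less.IH assms(1,3,4) in \<open>auto simp: somos5_formal_initial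
        integral_at_diff integral_at_mult\<close>)
  next
    case False
    then show ?thesis
      using assms(2) less.prems by (simp add: somos5_formal_initial)
  qed
qed

lemma somos5_step_value:
  assumes "somos5_step \<alpha> \<beta> f n" "regular a \<alpha>" "regular a \<beta>" "\<And>j. n \<le> j \<Longrightarrow> regular a (f j)"
  shows "somos5_step (ratfun_value a \<alpha>) (ratfun_value a \<beta>) (\<lambda>j. ratfun_value a (f j)) n"
  using arg_cong[OF assms(1)[unfolded somos5_step_def], of "ratfun_value a"] assms(2-4)
  by (simp add: somos5_step_def)

lemma on_level_value:
  assumes "on_level \<alpha> J f n" "regular a \<alpha>" "regular a J" "\<And>j. n \<le> j \<Longrightarrow> regular a (f j)"
  shows "on_level (ratfun_value a \<alpha>) (ratfun_value a J) (\<lambda>j. ratfun_value a (f j)) n"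
  using arg_cong[OF assms(1)[unfolded on_level_def level_set_def], of "ratfun_value a"] assms(2-4)
  by (simp add: on_level_def level_set_def)

lemma bilinear_value:
  assumes "bilinear b f" "\<And>j. regular a (b j)" "\<And>j. 1 \<le> j \<Longrightarrow> regular a (f j)"
  shows "bilinear (\<lambda>j. ratfun_value a (b j)) (\<lambda>j. ratfun_value a (f j))"
  unfolding bilinear_def
proof (intro allI impI)
  fix k i :: nat
  assume k: "k \<ge> 1"
  from assms(1)[unfolded bilinear_def, rule_format, OF k, of i, THEN arg_cong, of "ratfun_value a"]
  show "ratfun_value a (f (k + 2 * i + 3)) * ratfun_value a (f k) =
      ratfun_value a (b (i + 1)) * ratfun_value a (b (i + 2)) *
        (ratfun_value a (f (k + i + 3)) * ratfun_value a (f (k + i))) -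
      ratfun_value a (b i) * ratfun_value a (b (i + 3)) *
        (ratfun_value a (f (k + i + 2)) * ratfun_value a (f (k + i + 1)))"
    using k assms(2,3) by simp
qed

theorem corollary3p9:
  fixes \<alpha> \<beta> :: int and J :: rat and t1 t2 t3 t4 t5 :: int
  assumes "of_int \<alpha> * J \<in> \<int>"
    and "\<alpha> \<noteq> 0 \<or> \<beta> \<noteq> 0"
    and "quintic_solution \<alpha> \<beta> J (of_int t1, of_int t2, of_int t3, of_int t4, of_int t5)"
    and "\<bar>t1\<bar> = 1" and "\<bar>t2\<bar> = 1" and "t3 \<noteq> 0" and "t4 \<noteq> 0" and "t5 \<noteq> 0"
    and "\<not> somos5_periodic (somos5 \<alpha> \<beta> t1 t2 t3 t4 t5)"
  shows "orbit (somos5 \<alpha> \<beta> t1 t2 t3 t4 t5) \<subseteq> integer_quintic_solutions \<alpha> \<beta> J \<and>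
         infinite (orbit (somos5 \<alpha> \<beta> t1 t2 t3 t4 t5))"
proof -
  define a :: "nat \<Rightarrow> rat" where "a = (\<lambda>_. 0)(1 := of_int t1, 2 := of_int t2, 3 := of_int t3,
    4 := of_int t4, 5 := of_int t5, 6 := of_int \<alpha>, 7 := of_int \<beta>)"
  define T where "T = somos5 \<alpha> \<beta> t1 t2 t3 t4 t5"
  have T: "T n = ratfun_value a (somos5_formal n)" for n
    by (simp add: T_def somos5_def a_def)
  have a: "a 1 = of_int t1" "a 2 = of_int t2" "a 3 = of_int t3" "a 4 = of_int t4" "a 5 = of_int t5"
    "a 6 = of_int \<alpha>" "a 7 = of_int \<beta>"
    by (simp_all add: a_def)
  have unit: "t1 = 1 \<or> t1 = - 1" "t2 = 1 \<or> t2 = - 1"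
    using assms(4,5) by linarith+
  have nz: "a 1 \<noteq> 0" "a 2 \<noteq> 0" "a 3 \<noteq> 0" "a 4 \<noteq> 0" "a 5 \<noteq> 0"
    using unit assms(6-8) unfolding a by auto
  have a_int: "a n \<in> \<int>" for n
    by (simp add: a_def)
  have J: "regular a formal_J" "ratfun_value a formal_J = J"
    using formal_J_value[OF nz, unfolded a] nz[unfolded a] assms(3)
    by (simp_all add: quintic_solution_def divide_eq_eq mult_ac)
  have b_int: "formal_companion n \<in> integral_at a" for n
    using assms(1) J a_int by (intro formal_companion_integral) (simp_all add: integral_at_def a)
  have f_int: "somos5_formal n \<in> integral_at a" if "n \<ge> 1" for n
    using that
  proof (rule somos5_formal_integral[OF b_int, rotated 3])
    show "inverse (variable 1) \<in> integral_at a" "inverse (variable 2) \<in> integral_at a"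
      using unit nz(1,2) by (auto simp: integral_at_def regular_inverse ratfun_value_inverse a a(1)[simplified])
  qed (simp add: integral_at_def a_int)
  have f_reg: "regular a (somos5_formal n)" and T_int: "T n \<in> \<int>" if "n \<ge> 1" for n
    using f_int[OF that] by (simp_all add: integral_at_def T)
  have step: "somos5_step (of_int \<alpha>) (of_int \<beta>) T n" if "n \<ge> 1" for n
    using somos5_step_value[OF somos5_formal_step[OF that], of a] f_reg that
    by (simp add: T[abs_def] a)
  have level: "on_level (of_int \<alpha>) J T n" if "n \<ge> 1" for n
    using on_level_value[OF somos5_formal_level[OF that], of a] f_reg J that
    by (simp add: T[abs_def] a)
  have "bilinear formal_companion somos5_formal"
    by (intro formal_bilinear somos5_formal_step somos5_formal_level somos5_formal_nonzero)
  then have bil: "bilinear (\<lambda>n. ratfun_value a (formal_companion n)) T"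
    using bilinear_value[of formal_companion somos5_formal a] b_int f_reg
    by (simp add: integral_at_def T[abs_def])
  have T_init: "T n \<noteq> 0" if "1 \<le> n" "n \<le> 5" for n
  proof -
    have "n \<in> {1..5}"
      using that by simp
    then show ?thesis
      using nz unfolding one_to_five by (auto simp: T somos5_formal_initial)
  qed
  have iso: "isolated_zeros T n" if "n \<ge> 1" for n
    using zeros_isolated[OF step T_init] assms(2) that by simp
  have "quintic_solution \<alpha> \<beta> J (T n, T (n + 1), T (n + 2), T (n + 3), T (n + 4))" if "n \<ge> 1" for n
    using quintic_level_set[OF step[OF that, unfolded somos5_step_def], of J]
      level[OF that, unfolded on_level_def level_set_def]
    by (simp add: quintic_solution_def)
  then have "orbit T \<subseteq> integer_quintic_solutions \<alpha> \<beta> J"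
    using T_int by (auto simp: orbit_def integer_quintic_solutions_def)
  moreover have "infinite (orbit T)"
    using finite_orbit_periodic[OF bil iso] assms(9) by (auto simp: T_def)
  ultimately show ?thesis
    by (simp add: T_def)
qed

end
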